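(* Marcus' conjecture, that every minimal positively $k$-spanning vector configuration in $\mathbb{R}^m$ has size at most $2km$, is false: for $k=2$ and $m=12$ there exists a minimal positively $2$-spanning vector configuration in $\mathbb{R}^{12}$ of size $49 > 48 = 2\cdot 2\cdot 12$.
   Context: A positively spanning vector configuration in $\mathbb{R}^m$ is a finite configuration of vectors (a multiset, i.e. repetitions are allowed) $U=\{u_1,\dots,u_n\}$ in $\mathbb{R}^m$ such that every $v\in\mathbb{R}^m$ can be written as $v=\lambda_1u_1+\dots+\lambda_nu_n$ with real numbers $\lambda_1,\dots,\lambda_n\ge 0$. A positively $k$-spanning vector configuration is a positively spanning vector configuration that is still positively spanning after deleting any at most $k-1$ of its vectors (counted with multiplicity). It is minimal if it is minimal with respect to inclusion among positively $k$-spanning configurations, i.e. no proper subconfiguration is positively $k$-spanning. The size is the number of vectors counted with multiplicity. *)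

theory Defs
  imports "HOL-Library.Multiset" "Jordan_Normal_Form.Matrix"
begin

text \<open>
  The space \<open>\<real>\<^sup>m\<close> is the carrier \<^term>\<open>carrier_vec m :: real vec set\<close>, so that the dimension
  can be quantified over inside a formula.  Listing the multiset as \<open>us\<close> gives each copy of a
  repeated vector its own coefficient; the choice of the listing does not matter.
\<close>

definition positively_spanning :: "nat \<Rightarrow> real vec multiset \<Rightarrow> bool" where
  "positively_spanning m U \<longleftrightarrow>
     set_mset U \<subseteq> carrier_vec m \<and>
     (\<exists>us. mset us = U \<and>
        (\<forall>v \<in> carrier_vec m. \<exists>c :: nat \<Rightarrow> real.
           (\<forall>i < length us. 0 \<le> c i) \<and>
           v = finsum_vec TYPE(real) m (\<lambda>i. c i \<cdot>\<^sub>v us ! i) {..<length us}))"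

definition positively_k_spanning :: "nat \<Rightarrow> nat \<Rightarrow> real vec multiset \<Rightarrow> bool" where
  "positively_k_spanning m k U \<longleftrightarrow>
     positively_spanning m U \<and>
     (\<forall>D. D \<subseteq># U \<and> size D \<le> k - 1 \<longrightarrow> positively_spanning m (U - D))"

definition minimal_positively_k_spanning :: "nat \<Rightarrow> nat \<Rightarrow> real vec multiset \<Rightarrow> bool" where
  "minimal_positively_k_spanning m k U \<longleftrightarrow>
     positively_k_spanning m k U \<and> (\<forall>V. V \<subset># U \<longrightarrow> \<not> positively_k_spanning m k V)"

definition Marcus_conjecture :: bool where
  "Marcus_conjecture \<longleftrightarrow>
     (\<forall>k \<ge> 1. \<forall>m \<ge> 1. \<forall>U. minimal_positively_k_spanning m k U \<longrightarrow> size U \<le> 2 * k * m)"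

end

theory Submission
  imports Defs
begin

text \<open>
  Let \<open>a\<^sub>0, \<dots>, a\<^sub>6\<close> span \<open>\<real>\<^sup>6\<close> and sum to zero, and let \<open>f\<^sub>0, \<dots>, f\<^sub>5\<close> be a basis of a complementary
  \<open>\<real>\<^sup>6\<close>, with sum \<open>F\<close>.  The configuration consists of the \<open>7\<close> vectors \<open>w\<^sub>j = 30 a\<^sub>j - F\<close> and the
  \<open>42\<close> vectors \<open>v\<^sub>i\<^sub>j = f\<^sub>i + a\<^sub>j\<close>.

  The sums over \<open>j\<close> give \<open>7 f\<^sub>i\<close> and \<open>-7 F\<close>, so the positive hull contains all \<open>\<plusminus>f\<^sub>i\<close>, hence all
  \<open>a\<^sub>j\<close> and their negatives.  When one vector is deleted, the lost sum is recovered from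
  \<open>29 f\<^sub>i = 5 (\<Sum>j'\<noteq>j. v\<^sub>i\<^sub>j\<^sub>') + (\<Sum>i'\<noteq>i. v\<^sub>i\<^sub>'\<^sub>j) - F\<close> and
  \<open>-F = (\<Sum>j'\<noteq>j. w\<^sub>j\<^sub>') + 5 (\<Sum>i. v\<^sub>i\<^sub>j)\<close> respectively.

  For minimality, the linear functional with \<open>a\<^sub>j \<mapsto> 6\<close>, \<open>a\<^sub>j\<^sub>' \<mapsto> -1\<close>, \<open>f\<^sub>i \<mapsto> 1\<close>, \<open>f\<^sub>i\<^sub>' \<mapsto> -6\<close> is
  positive on \<open>w\<^sub>j\<close> and \<open>v\<^sub>i\<^sub>j\<close> only, so no configuration avoiding both of them positively spans.
\<close>

section \<open>Positively spanning sets of vectors\<close>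

text \<open>The listing of a set has no repetitions, so coefficients indexed by positions and by
  vectors correspond through a bijection. Everything later can then be computed in
  coordinates.\<close>

lemma positively_spanning_mset_set:
  assumes "finite S"
  shows "positively_spanning m (mset_set S) \<longleftrightarrow> S \<subseteq> carrier_vec m \<and>
    (\<forall>v \<in> carrier_vec m. \<exists>c. (\<forall>u\<in>S. 0 \<le> c u) \<and> (\<forall>k<m. v $ k = (\<Sum>u\<in>S. c u * u $ k)))"
    (is "?L \<longleftrightarrow> _ \<and> ?R")
proof (cases "S \<subseteq> carrier_vec m")
  case False
  then show ?thesis using assms by (simp add: positively_spanning_def)
next
  case S: True
  have listing: "(\<exists>c::nat \<Rightarrow> real. (\<forall>i < length us. 0 \<le> c i) \<and>
           v = finsum_vec TYPE(real) m (\<lambda>i. c i \<cdot>\<^sub>v us ! i) {..<length us}) \<longleftrightarrow>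
        (\<exists>c. (\<forall>u\<in>S. 0 \<le> c u) \<and> (\<forall>k<m. v $ k = (\<Sum>u\<in>S. c u * u $ k)))"
    (is "?A \<longleftrightarrow> ?B")
    if us: "mset us = mset_set S" and v: "v \<in> carrier_vec m" for us v
  proof -
    have set: "set us = S" using us assms by (metis finite_set_mset_mset_set set_mset_mset)
    have "distinct us"
      using us set by (metis distinct_count_atmost_1 count_mset_set(1,3) assms)
    then have bij: "bij_betw ((!) us) {..<length us} S"
      using set by (simp add: bij_betw_nth)
    have mem: "us ! i \<in> S" if "i < length us" for i using set that by auto
    then have carr: "us ! i \<in> carrier_vec m" if "i < length us" for i using S that by auto
    have eq: "v = finsum_vec TYPE(real) m (\<lambda>i. c i \<cdot>\<^sub>v us ! i) {..<length us} \<longleftrightarrow>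
       (\<forall>k<m. v $ k = (\<Sum>i<length us. c i * us ! i $ k))" (is "v = ?s \<longleftrightarrow> _") for c :: "nat \<Rightarrow> real"
    proof -
      have car: "?s \<in> carrier_vec m"
        by (rule finsum_vec_closed) (use carr in auto)
      have idx: "?s $ k = (\<Sum>i<length us. c i * us ! i $ k)" if "k < m" for k
      proof -
        have "?s $ k = (\<Sum>i<length us. (c i \<cdot>\<^sub>v us ! i) $ k)"
          using carr that by (subst index_finsum_vec) auto
        also have "\<dots> = (\<Sum>i<length us. c i * us ! i $ k)"
          using carrier_vecD[OF carr] that by (intro sum.cong refl) simp
        finally show ?thesis .
      qed
      show ?thesis using car v idx by (auto intro!: eq_vecI)
    qed
    show ?thesis
    proof
      assume ?A
      then obtain c where c: "\<forall>i < length us. 0 \<le> c i"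
        "\<forall>k<m. v $ k = (\<Sum>i<length us. c i * us ! i $ k)" unfolding eq by blast
      define d where "d u = c (the_inv_into {..<length us} ((!) us) u)" for u
      have d: "d (us ! i) = c i" if "i < length us" for i
        using bij that by (simp add: d_def the_inv_into_f_f bij_betw_def)
      have "(\<Sum>u\<in>S. d u * u $ k) = (\<Sum>i<length us. c i * us ! i $ k)" for k
        using sum.reindex_bij_betw[OF bij, of "\<lambda>u. d u * u $ k"] d by simp
      moreover have "\<forall>u\<in>S. 0 \<le> d u"
        using d c(1) set by (metis in_set_conv_nth)
      ultimately show ?B using c(2) by (intro exI[of _ d]) simp
    next
      assume ?B
      then obtain d where d: "\<forall>u\<in>S. 0 \<le> d u" "\<forall>k<m. v $ k = (\<Sum>u\<in>S. d u * u $ k)" by blast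
      then show ?A unfolding eq
        using mem sum.reindex_bij_betw[OF bij, of "\<lambda>u. d u * u $ _"]
        by (intro exI[of _ "\<lambda>i. d (us ! i)"]) simp
    qed
  qed
  have "?L \<longleftrightarrow> (\<exists>us. mset us = mset_set S \<and> ?R)"
    using S assms listing by (simp add: positively_spanning_def cong: conj_cong)
  also have "\<dots> \<longleftrightarrow> ?R" using ex_mset by blast
  finally show ?thesis using S by simp
qed

text \<open>The easy half of Farkas' lemma: a functional nonpositive on the generators stays
  nonpositive on their positive hull, which therefore misses \<open>v\<close>.\<close>

lemma not_positively_spanning_if_functional:
  fixes y :: "nat \<Rightarrow> real"
  assumes "finite S" and "\<And>u. u \<in> S \<Longrightarrow> (\<Sum>k<m. y k * u $ k) \<le> 0" and "v \<in> carrier_vec m"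
    and "(\<Sum>k<m. y k * v $ k) > 0"
  shows "\<not> positively_spanning m (mset_set S)"
proof
  assume "positively_spanning m (mset_set S)"
  then obtain c where c: "\<forall>u\<in>S. 0 \<le> c u" "\<forall>k<m. v $ k = (\<Sum>u\<in>S. c u * u $ k)"
    using assms by (auto simp: positively_spanning_mset_set)
  have "(\<Sum>k<m. y k * v $ k) = (\<Sum>k<m. \<Sum>u\<in>S. c u * (y k * u $ k))"
    using c(2) by (simp add: sum_distrib_left mult_ac)
  also have "\<dots> = (\<Sum>u\<in>S. c u * (\<Sum>k<m. y k * u $ k))"
    by (subst sum.swap) (simp add: sum_distrib_left)
  also have "\<dots> \<le> 0"
    using c(1) assms(2) by (blast intro: sum_nonpos mult_nonneg_nonpos)
  finally show False using assms(4) by simp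
qed

lemma mset_set_diff_singleton: "finite S \<Longrightarrow> mset_set S - {#u#} = mset_set (S - {u})"
  by (cases "u \<in> S") (simp_all add: mset_set_Diff)

lemma positively_2_spanning_mset_set:
  assumes "finite S" and "positively_spanning m (mset_set S)"
    and "\<And>u. u \<in> S \<Longrightarrow> positively_spanning m (mset_set (S - {u}))"
  shows "positively_k_spanning m 2 (mset_set S)"
  unfolding positively_k_spanning_def
proof (intro conjI allI impI)
  fix D assume D: "D \<subseteq># mset_set S \<and> size D \<le> 2 - 1"
  show "positively_spanning m (mset_set S - D)"
  proof (cases "D = {#}")
    case False
    then have "size D = 1" using D by (simp add: le_Suc_eq)
    then obtain u where "D = {#u#}" using size_1_singleton_mset by blast
    moreover from this have "u \<in> S" using D assms(1) by simp
    ultimately show ?thesis using assms by (simp add: mset_set_diff_singleton)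
  qed (use assms in simp)
qed (fact assms)

text \<open>A proper subconfiguration misses some \<open>u\<close>; deleting the partner
  \<open>u'\<close> as well uses the one allowed deletion and leaves a set that cannot span.\<close>

lemma minimal_positively_2_spanning_mset_set:
  assumes "finite S" and "positively_k_spanning m 2 (mset_set S)"
    and pair: "\<And>u. u \<in> S \<Longrightarrow> \<exists>u'\<in>S. \<forall>T \<subseteq> S - {u, u'}. \<not> positively_spanning m (mset_set T)"
  shows "minimal_positively_k_spanning m 2 (mset_set S)"
  unfolding minimal_positively_k_spanning_def
proof (intro conjI allI impI notI)
  fix V assume V: "V \<subset># mset_set S" and span: "positively_k_spanning m 2 V"
  define T where "T = set_mset V"
  have T: "finite T" "T \<subseteq> S"
    using V assms(1) by (auto simp: T_def dest!: set_mset_mono subset_mset.less_imp_le)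
  \<comment> \<open>All multiplicities in \<open>mset_set S\<close> are at most one, and this passes
    to subconfigurations.\<close>
  have VT: "V = mset_set T"
  proof (rule multiset_eqI)
    fix u
    have "count V u \<le> count (mset_set S) u"
      using V by (simp add: mset_subset_eq_count subset_mset.less_imp_le)
    also have "\<dots> \<le> 1" by (simp add: count_mset_set')
    finally show "count V u = count (mset_set T) u"
      using T(1) count_greater_zero_iff[of V u]
      by (cases "u \<in># V") (auto simp: T_def le_Suc_eq not_in_iff simp del: count_greater_zero_iff)
  qed
  have "T \<noteq> S" using V VT by auto
  with T(2) obtain u where u: "u \<in> S" "u \<notin> T" by blast
  from pair[OF u(1)] obtain u'
    where u': "\<And>T. T \<subseteq> S - {u, u'} \<Longrightarrow> \<not> positively_spanning m (mset_set T)" by blast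
  have "positively_spanning m (mset_set (T - {u'}))"
  proof (cases "u' \<in> T")
    case True
    then have "positively_spanning m (V - {#u'#})"
      using span T by (auto simp: positively_k_spanning_def VT)
    then show ?thesis using T by (simp add: VT mset_set_diff_singleton)
  next
    case False
    then show ?thesis using span by (simp add: positively_k_spanning_def VT)
  qed
  moreover have "T - {u'} \<subseteq> S - {u, u'}" using T u by auto
  ultimately show False using u' by blast
qed (fact assms)

section \<open>The configuration\<close>

definition simplex_vec :: "nat \<Rightarrow> nat \<Rightarrow> real" where
  "simplex_vec j k = (if j = 6 then (if k < 6 then -1 else 0) else if k = j then 1 else 0)"

definition basis_vec :: "nat \<Rightarrow> nat \<Rightarrow> real" where
  "basis_vec i k = (if k = 6 + i then 1 else 0)"

definition basis_total :: "nat \<Rightarrow> real" where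
  "basis_total k = (if 6 \<le> k then 1 else 0)"

text \<open>With a factor c in place of 30, the separating functional is nonpositive on the other
  \<open>wvec\<close> iff c \<ge> 29, and -F can be recovered after a deletion as below iff c < 36.
  The value 30 makes the multiplier c/6 = 5 an integer.\<close>

definition wvec :: "nat \<Rightarrow> nat \<Rightarrow> real" where
  "wvec j k = 30 * simplex_vec j k - basis_total k"

definition vvec :: "nat \<Rightarrow> nat \<Rightarrow> nat \<Rightarrow> real" where
  "vvec i j k = basis_vec i k + simplex_vec j k"

lemma sum_lessThan_12: "(\<Sum>k<12. h k) = (\<Sum>k<6. h k) + (\<Sum>i<6. h (6 + i))"
  for h :: "nat \<Rightarrow> real"
  by (simp add: numeral_eq_Suc)

lemma sum_simplex_vec: "(\<Sum>j<7. simplex_vec j k) = 0"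
proof -
  have "(\<Sum>j<7. simplex_vec j k) = (\<Sum>j<6. simplex_vec j k) + simplex_vec 6 k"
    using sum.lessThan_Suc[of "\<lambda>j. simplex_vec j k" 6] by simp
  then show ?thesis by (simp add: simplex_vec_def)
qed

lemma sum_basis_vec:
  assumes "k < 12"
  shows "(\<Sum>i<6. basis_vec i k) = basis_total k"
proof (cases "k < 6")
  case False
  then have "(k = 6 + i) = (i = k - 6)" for i by auto
  then show ?thesis using assms False by (simp add: basis_vec_def basis_total_def)
qed (auto simp: basis_vec_def basis_total_def)

lemma sum_simplex_vec_except:
  assumes "j < 7"
  shows "(\<Sum>j'\<in>{..<7}-{j}. simplex_vec j' k) = - simplex_vec j k"
  using sum_simplex_vec[of k] assms by (simp add: sum_diff1)

lemma sum_basis_vec_except: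
  assumes "k < 12" "i < 6"
  shows "(\<Sum>i'\<in>{..<6}-{i}. basis_vec i' k) = basis_total k - basis_vec i k"
  using sum_basis_vec[OF assms(1)] assms(2) by (simp add: sum_diff1)

lemma standard_expansion:
  assumes "k < 12"
  shows "(\<Sum>j<6. g j * simplex_vec j k) + (\<Sum>i<6. g (6 + i) * basis_vec i k) = g k"
proof (cases "k < 6")
  case True
  then show ?thesis by (simp add: simplex_vec_def basis_vec_def if_distrib[of "(*) _"] cong: if_cong)
next
  case False
  then have "(k = 6 + i) = (i = k - 6)" for i by auto
  then show ?thesis
    using assms False by (simp add: simplex_vec_def basis_vec_def if_distrib[of "(*) _"] cong: if_cong)
qed

section \<open>Cones containing all but one vector of the configuration\<close>

text \<open>Vectors are functions read only below 12, so membership must ignore other arguments;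
  \<open>basis_total\<close> is the sum of the \<open>basis_vec i\<close> only in that
  range.\<close>

locale cone12 =
  fixes K :: "(nat \<Rightarrow> real) \<Rightarrow> bool"
  assumes zero_mem: "K (\<lambda>k. 0)"
    and combine_mem: "K g \<Longrightarrow> K h \<Longrightarrow> 0 \<le> s \<Longrightarrow> 0 \<le> t \<Longrightarrow>
      (\<And>k. k < 12 \<Longrightarrow> r k = s * g k + t * h k) \<Longrightarrow> K r"
begin

lemma scale_mem: "K g \<Longrightarrow> 0 \<le> s \<Longrightarrow> (\<And>k. k < 12 \<Longrightarrow> r k = s * g k) \<Longrightarrow> K r"
  using combine_mem[of g g s 0 r] by simp

lemma add_mem: "K g \<Longrightarrow> K h \<Longrightarrow> (\<And>k. k < 12 \<Longrightarrow> r k = g k + h k) \<Longrightarrow> K r"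
  using combine_mem[of g h 1 1 r] by simp

lemma sum_mem: "finite I \<Longrightarrow> (\<And>i. i \<in> I \<Longrightarrow> K (h i)) \<Longrightarrow> K (\<lambda>k. \<Sum>i\<in>I. h i k)"
proof (induction I rule: finite_induct)
  case (insert i I)
  then have "K (h i)" "K (\<lambda>k. \<Sum>i\<in>I. h i k)" by auto
  then show ?case by (rule add_mem) (use insert in simp)
qed (simp add: zero_mem)

text \<open>Adding the other f's to -F gives -f_i, then v_ij - f_i gives a_j, and the sum of the
  other a's gives -a_j. The cone thus contains both signs of a basis. One v_ij per j suffices, so a
  deleted one does no harm.\<close>

lemma eq_UNIV:
  assumes f: "\<And>i. i < 6 \<Longrightarrow> K (basis_vec i)"
    and F: "K (\<lambda>k. - basis_total k)"
    and v: "\<And>j. j < 7 \<Longrightarrow> \<exists>i<6. K (vvec i j)"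
  shows "K g"
proof -
  have nf: "K (\<lambda>k. - basis_vec i k)" if i: "i < 6" for i
    by (rule add_mem[OF F sum_mem[of "{..<6}-{i}" basis_vec]])
      (use f i in \<open>auto simp: sum_basis_vec_except\<close>)
  have a: "K (simplex_vec j)" if j: "j < 7" for j
  proof -
    from v[OF j] obtain i where i: "i < 6" "K (vvec i j)" by blast
    show ?thesis by (rule add_mem[OF i(2) nf[OF i(1)]]) (simp add: vvec_def)
  qed
  have na: "K (\<lambda>k. - simplex_vec j k)" if j: "j < 7" for j
    by (rule scale_mem[OF sum_mem[of "{..<7}-{j}" simplex_vec], of 1])
      (use a j in \<open>auto simp: sum_simplex_vec_except\<close>)
  have line: "K (\<lambda>k. c * h k)" if "K h" "K (\<lambda>k. - h k)" for c h
  proof (cases "0 \<le> c")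
    case True
    with that(1) show ?thesis by (rule scale_mem) simp
  next
    case False
    then have "0 \<le> - c" by simp
    with that(2) show ?thesis by (rule scale_mem) simp
  qed
  show ?thesis
    by (rule add_mem[OF sum_mem[of "{..<6}" "\<lambda>j k. g j * simplex_vec j k"]
          sum_mem[of "{..<6}" "\<lambda>i k. g (6 + i) * basis_vec i k"]])
      (simp_all add: line[OF a na] line[OF f nf] standard_expansion)
qed

lemma basis_vec_mem:
  assumes "\<And>j. j < 7 \<Longrightarrow> K (vvec i j)"
  shows "K (basis_vec i)"
  by (rule scale_mem[OF sum_mem[of "{..<7}" "vvec i"], of "1/7"])
    (use assms in \<open>auto simp: vvec_def sum.distrib sum_simplex_vec\<close>)

lemma neg_basis_total_mem:
  assumes "\<And>j. j < 7 \<Longrightarrow> K (wvec j)"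
  shows "K (\<lambda>k. - basis_total k)"
  by (rule scale_mem[OF sum_mem[of "{..<7}" "wvec"], of "1/7"])
    (use assms in \<open>auto simp: wvec_def sum_subtractf sum_simplex_vec simp flip: sum_distrib_left\<close>)

lemma eq_UNIV_without_vvec:
  assumes i0: "i0 < 6" and j0: "j0 < 7"
    and w: "\<And>j. j < 7 \<Longrightarrow> K (wvec j)"
    and v: "\<And>i j. i < 6 \<Longrightarrow> j < 7 \<Longrightarrow> (i, j) \<noteq> (i0, j0) \<Longrightarrow> K (vvec i j)"
  shows "K g"
proof (rule eq_UNIV)
  show F: "K (\<lambda>k. - basis_total k)" using w by (rule neg_basis_total_mem)
  have "K (\<lambda>k. 6 * basis_vec i0 k - simplex_vec j0 k)"
    by (rule scale_mem[OF sum_mem[of "{..<7}-{j0}" "vvec i0"], of 1])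
      (use v i0 j0 in \<open>auto simp: vvec_def sum.distrib sum_simplex_vec_except\<close>)
  moreover have "K (\<lambda>k. 5 * simplex_vec j0 k + (basis_total k - basis_vec i0 k))"
    by (rule scale_mem[OF sum_mem[of "{..<6}-{i0}" "\<lambda>i. vvec i j0"], of 1])
      (use v i0 j0 in \<open>auto simp: vvec_def sum.distrib sum_basis_vec_except\<close>)
  \<comment> \<open>Weights 5 and 1 cancel the a-terms and leave 30 f - f + F.\<close>
  ultimately have "K (\<lambda>k. 29 * basis_vec i0 k + basis_total k)"
    by (rule combine_mem[of _ _ 5 1]) auto
  from this F have fi0: "K (basis_vec i0)"
    by (rule combine_mem[of _ _ "1/29" "1/29"]) (simp_all add: field_simps)
  show "K (basis_vec i)" if i: "i < 6" for i
  proof (cases "i = i0")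
    case False
    then show ?thesis using v i by (intro basis_vec_mem) auto
  qed (use fi0 in simp)
  show "\<exists>i<6. K (vvec i j)" if j: "j < 7" for j
  proof -
    have "\<exists>i<6. i \<noteq> i0" by (rule exI[of _ "if i0 = 0 then 1 else 0"]) auto
    then show ?thesis using v j by blast
  qed
qed

lemma eq_UNIV_without_wvec:
  assumes j0: "j0 < 7"
    and w: "\<And>j. j < 7 \<Longrightarrow> j \<noteq> j0 \<Longrightarrow> K (wvec j)"
    and v: "\<And>i j. i < 6 \<Longrightarrow> j < 7 \<Longrightarrow> K (vvec i j)"
  shows "K g"
proof (rule eq_UNIV)
  have "K (\<lambda>k. - 30 * simplex_vec j0 k - 6 * basis_total k)"
    by (rule scale_mem[OF sum_mem[of "{..<7}-{j0}" wvec], of 1])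
      (use w j0 in \<open>auto simp: wvec_def sum_subtractf sum_simplex_vec_except simp flip: sum_distrib_left\<close>)
  moreover have "K (\<lambda>k. basis_total k + 6 * simplex_vec j0 k)"
    by (rule scale_mem[OF sum_mem[of "{..<6}" "\<lambda>i. vvec i j0"], of 1])
      (use v j0 in \<open>auto simp: vvec_def sum.distrib sum_basis_vec\<close>)
  \<comment> \<open>Weights 1 and 5 cancel the a-terms, and -6 F + 5 F remains.\<close>
  ultimately show "K (\<lambda>k. - basis_total k)"
    by (rule combine_mem[of _ _ 1 5]) auto
  show "K (basis_vec i)" if "i < 6" for i using v that by (intro basis_vec_mem) auto
  show "\<exists>i<6. K (vvec i j)" if "j < 7" for j using v that by (intro exI[of _ 0]) auto
qed

end

section \<open>Separating functionals\<close>

text \<open>For j = 6 the first six coordinates are all -1; since a_6 is minus the sum of the other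
  a's, it receives the value 6 as desired.\<close>

definition functional :: "nat \<Rightarrow> nat \<Rightarrow> nat \<Rightarrow> real" where
  "functional i j k = (if k < 6 then (if k = j then 6 else -1) else if k = 6 + i then 1 else -6)"

lemma functional_simplex_vec:
  assumes "j < 7" "j' < 7"
  shows "(\<Sum>k<12. functional i j k * simplex_vec j' k) = (if j' = j then 6 else -1)"
proof (cases "j' = 6")
  case True
  \<comment> \<open>On these coordinates the functional is -1 plus 7 at \<open>k = j\<close>, and
    a_6 flips the sign.\<close>
  have "(\<Sum>k<12. functional i j k * simplex_vec j' k) = (\<Sum>k<6. 1 - (if k = j then 7 else 0))"
    unfolding sum_lessThan_12 by (auto simp: functional_def simplex_vec_def True intro!: sum.cong)
  also have "\<dots> = 6 - (if j < 6 then 7 else 0)"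
    by (simp add: sum_subtractf)
  finally show ?thesis using True assms by auto
next
  case False
  then show ?thesis
    using assms by (simp add: sum_lessThan_12 functional_def simplex_vec_def if_distrib[of "(*) _"] cong: if_cong)
qed

lemma functional_basis_vec:
  assumes "i' < 6"
  shows "(\<Sum>k<12. functional i j k * basis_vec i' k) = (if i' = i then 1 else -6)"
  using assms by (simp add: sum_lessThan_12 functional_def basis_vec_def if_distrib[of "(*) _"] cong: if_cong)

lemma functional_basis_total:
  assumes "i < 6"
  shows "(\<Sum>k<12. functional i j k * basis_total k) = -29"
proof -
  have "(\<Sum>k<12. functional i j k * basis_total k) = (\<Sum>i'<6. (if i' = i then 7 else 0) - 6)"
    unfolding sum_lessThan_12 by (auto simp: functional_def basis_total_def intro!: sum.cong)
  also have "\<dots> = -29" using assms by (simp add: sum_subtractf)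
  finally show ?thesis .
qed

lemma functional_wvec:
  assumes "i < 6" "j < 7" "j' < 7"
  shows "(\<Sum>k<12. functional i j k * wvec j' k) = (if j' = j then 209 else -1)"
proof -
  have "(\<Sum>k<12. functional i j k * wvec j' k) =
    30 * (\<Sum>k<12. functional i j k * simplex_vec j' k) - (\<Sum>k<12. functional i j k * basis_total k)"
    by (simp add: wvec_def right_diff_distrib sum_subtractf sum_distrib_left mult_ac)
  then show ?thesis
    using assms by (simp add: functional_simplex_vec functional_basis_total)
qed

text \<open>The value is 7 if both indices agree, 0 if exactly one does, and -7 otherwise, so only
  v_ij is positive.\<close>

lemma functional_vvec:
  assumes "j < 7" "i' < 6" "j' < 7"
  shows "(\<Sum>k<12. functional i j k * vvec i' j' k) =
    (if i' = i then 1 else -6) + (if j' = j then 6 else -1)"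
proof -
  have "(\<Sum>k<12. functional i j k * vvec i' j' k) =
    (\<Sum>k<12. functional i j k * basis_vec i' k) + (\<Sum>k<12. functional i j k * simplex_vec j' k)"
    by (simp add: vvec_def distrib_left sum.distrib)
  then show ?thesis
    using assms by (simp add: functional_simplex_vec functional_basis_vec)
qed

section \<open>The 49 vectors and their distinctness\<close>

definition W :: "nat \<Rightarrow> real vec" where "W j = vec 12 (wvec j)"

definition V :: "nat \<Rightarrow> nat \<Rightarrow> real vec" where "V i j = vec 12 (vvec i j)"

definition config :: "real vec set" where
  "config = W ` {..<7} \<union> (\<lambda>(i, j). V i j) ` ({..<6} \<times> {..<7})"

lemma config_cases:
  assumes "u \<in> config"
  obtains j where "j < 7" "u = W j" | i j where "i < 6" "j < 7" "u = V i j"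
  using assms by (auto simp: config_def)

lemma W_in_config: "j < 7 \<Longrightarrow> W j \<in> config"
  and V_in_config: "i < 6 \<Longrightarrow> j < 7 \<Longrightarrow> V i j \<in> config"
  by (auto simp: config_def)

lemma finite_config: "finite config"
  by (simp add: config_def)

lemma config_carrier: "config \<subseteq> carrier_vec 12"
  by (auto simp: config_def W_def V_def)

lemma W_inject:
  assumes "j < 7" "j' < 7" "W j = W j'"
  shows "j = j'"
proof -
  \<comment> \<open>The functional is 209 at \<open>W j\<close> and -1 at every other
    \<open>W j'\<close>.\<close>
  have "(\<Sum>k<12. functional 0 j k * W j $ k) = (\<Sum>k<12. functional 0 j k * W j' $ k)"
    using assms(3) by simp
  then show ?thesis
    using assms(1,2) by (simp add: W_def functional_wvec split: if_splits)
qed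

lemma V_inject:
  assumes "i < 6" "j < 7" "i' < 6" "j' < 7" "V i j = V i' j'"
  shows "i = i' \<and> j = j'"
proof -
  have "(\<Sum>k<12. functional i j k * V i j $ k) = (\<Sum>k<12. functional i j k * V i' j' $ k)"
    using assms(5) by simp
  then show ?thesis
    using assms(1-4) by (simp add: V_def functional_vvec split: if_splits)
qed

lemma W_neq_V:
  assumes "j < 7" "j' < 7"
  shows "W j \<noteq> V i j'"
proof
  assume "W j = V i j'"
  \<comment> \<open>No a has a component in this coordinate: the left side is -1, the right side 0
    or 1.\<close>
  then have "W j $ 11 = V i j' $ 11" by simp
  then show False
    using assms by (auto simp: W_def V_def wvec_def vvec_def simplex_vec_def basis_vec_def
        basis_total_def split: if_splits)
qed

lemma card_config: "card config = 49"
proof -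
  have "card (W ` {..<7}) = 7"
    using W_inject by (subst card_image) (auto simp: inj_on_def)
  moreover have "card ((\<lambda>(i, j). V i j) ` ({..<6} \<times> {..<7})) = 42"
    using V_inject by (subst card_image) (fastforce simp: inj_on_def)+
  moreover have "W ` {..<7} \<inter> (\<lambda>(i, j). V i j) ` ({..<6} \<times> {..<7}) = {}"
    using W_neq_V by auto
  ultimately show ?thesis unfolding config_def by (subst card_Un_disjoint) auto
qed

section \<open>Positive 2-spanning and minimality\<close>

lemma cone12_nonneg_combinations:
  fixes S :: "real vec set"
  shows "cone12 (\<lambda>g. \<exists>c. (\<forall>u\<in>S. 0 \<le> c u) \<and> (\<forall>k<12. g k = (\<Sum>u\<in>S. c u * u $ k)))"
proof (unfold_locales, goal_cases)
  case 1
  then show ?case by (intro exI[of _ "\<lambda>u. 0"]) simp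
next
  case (2 g h s t r)
  from 2(1,2) obtain c d where
    c: "\<forall>u\<in>S. 0 \<le> c u" "\<forall>k<12. g k = (\<Sum>u\<in>S. c u * u $ k)" and
    d: "\<forall>u\<in>S. 0 \<le> d u" "\<forall>k<12. h k = (\<Sum>u\<in>S. d u * u $ k)" by blast
  then show ?case using 2(3-)
    by (intro exI[of _ "\<lambda>u. s * c u + t * d u"])
      (simp add: distrib_right sum.distrib sum_distrib_left mult.assoc)
qed

text \<open>Allowing \<open>S\<close> to be all of \<open>config\<close> or to lack
  \<open>u0\<close> treats the full configuration and every single deletion together.\<close>

lemma positively_spanning_config_minus:
  assumes "u0 \<in> config" and S: "config - {u0} \<subseteq> S" "S \<subseteq> config"
  shows "positively_spanning 12 (mset_set S)"
proof -
  define K where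
    "K g \<longleftrightarrow> (\<exists>c. (\<forall>u\<in>S. 0 \<le> c u) \<and> (\<forall>k<12. g k = (\<Sum>u\<in>S. c u * u $ k)))"
    for g :: "nat \<Rightarrow> real"
  interpret cone12 K
    using cone12_nonneg_combinations[of S] by (simp add: K_def[abs_def])
  have fin: "finite S" using S(2) finite_config by (rule finite_subset)
  have mem: "K h" if "vec 12 h \<in> S" for h
    unfolding K_def using fin that
    by (intro exI[of _ "\<lambda>u. if u = vec 12 h then 1 else 0"])
      (simp add: if_distrib[of "\<lambda>x. x * _"] cong: if_cong)
  have w: "K (wvec j)" if "j < 7" "W j \<noteq> u0" for j
    using that S(1) W_in_config[of j] by (intro mem) (auto simp flip: W_def)
  have v: "K (vvec i j)" if "i < 6" "j < 7" "V i j \<noteq> u0" for i j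
    using that S(1) V_in_config[of i j] by (intro mem) (auto simp flip: V_def)
  have "K g" for g
    using assms(1)
  proof (cases rule: config_cases)
    case (1 j)
    show ?thesis
    proof (rule eq_UNIV_without_wvec[OF 1(1)])
      show "K (wvec j')" if "j' < 7" "j' \<noteq> j" for j'
        using that 1 W_inject by (intro w) auto
      show "K (vvec i j')" if "i < 6" "j' < 7" for i j'
        using that 1 W_neq_V[of j j' i] by (intro v) auto
    qed
  next
    case (2 i j)
    show ?thesis
    proof (rule eq_UNIV_without_vvec[OF 2(1,2)])
      show "K (wvec j')" if "j' < 7" for j'
        using that 2 W_neq_V[of j' j i] by (intro w) auto
      show "K (vvec i' j')" if "i' < 6" "j' < 7" "(i', j') \<noteq> (i, j)" for i' j'
        using that 2 V_inject[of i' j' i j] by (intro v) auto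
    qed
  qed
  then show ?thesis
    using fin S(2) config_carrier by (auto simp: positively_spanning_mset_set K_def)
qed

lemma not_positively_spanning_config_minus_pair:
  assumes "i < 6" "j < 7" and T: "T \<subseteq> config - {W j, V i j}"
  shows "\<not> positively_spanning 12 (mset_set T)"
proof (rule not_positively_spanning_if_functional)
  show "finite T" using T finite_config finite_subset by blast
  show "W j \<in> carrier_vec 12" by (simp add: W_def)
  show "(\<Sum>k<12. functional i j k * W j $ k) > 0"
    using assms by (simp add: W_def functional_wvec)
  fix u assume "u \<in> T"
  with T have u: "u \<in> config" "u \<noteq> W j" "u \<noteq> V i j" by auto
  from u(1) show "(\<Sum>k<12. functional i j k * u $ k) \<le> 0"
  proof (cases rule: config_cases)
    case (1 j')
    then show ?thesis using u assms by (auto simp: W_def functional_wvec)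
  next
    case (2 i' j')
    then show ?thesis using u assms by (auto simp: V_def functional_vvec)
  qed
qed

lemma minimal_positively_2_spanning_config:
  "minimal_positively_k_spanning 12 2 (mset_set config)"
proof (rule minimal_positively_2_spanning_mset_set[OF finite_config])
  show "positively_k_spanning 12 2 (mset_set config)"
    \<comment> \<open>\<open>W 0\<close> serves as \<open>u0\<close> for the full configuration,
      where nothing is deleted.\<close>
    using finite_config W_in_config[of 0]
    by (intro positively_2_spanning_mset_set) (auto intro: positively_spanning_config_minus)
  fix u assume "u \<in> config"
  then show "\<exists>u'\<in>config. \<forall>T \<subseteq> config - {u, u'}. \<not> positively_spanning 12 (mset_set T)"
  proof (cases rule: config_cases)
    case (1 j)
    then show ?thesis
      using not_positively_spanning_config_minus_pair[of 0 j]
      \<comment> \<open>Any \<open>V i j\<close> with the same \<open>j\<close> could be the partner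
        of \<open>W j\<close>.\<close>
      by (intro bexI[of _ "V 0 j"] V_in_config) auto
  next
    case (2 i j)
    then show ?thesis
      using not_positively_spanning_config_minus_pair[of i j]
      by (intro bexI[of _ "W j"] W_in_config) (auto simp: insert_commute)
  qed
qed

theorem mainTheorem3:
  shows "\<not> Marcus_conjecture \<and>
    (\<exists>U :: real vec multiset.
       minimal_positively_k_spanning 12 2 U \<and> size U = 49 \<and> size U > 2 * 2 * 12)"
proof -
  have min: "minimal_positively_k_spanning 12 2 (mset_set config)"
    by (rule minimal_positively_2_spanning_config)
  have size: "size (mset_set config) = 49" by (simp add: card_config)
  have "\<not> Marcus_conjecture"
  proof
    assume "Marcus_conjecture"
    then have "size (mset_set config) \<le> 2 * 2 * 12"
      unfolding Marcus_conjecture_def using min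
      by (metis one_le_numeral)
    with size show False by simp
  qed
  with min size show ?thesis by (intro conjI exI[of _ "mset_set config"]) auto
qed

end
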